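(* Let $x^3+px^2+qx+r$ (with $p,q,r\in\mathbb{R}$, $r\neq 0$) be a Ramanujan cubic polynomial (RCP) with roots $x_1,x_2,x_3$. Then $$\left(\frac{x_1}{x_2}\right)^{1/3}+\left(\frac{x_2}{x_1}\right)^{1/3}+\left(\frac{x_1}{x_3}\right)^{1/3}+\left(\frac{x_3}{x_1}\right)^{1/3}+\left(\frac{x_2}{x_3}\right)^{1/3}+\left(\frac{x_3}{x_2}\right)^{1/3}=\left(\frac{pq}{r}-9\right)^{1/3}.$$
   Context: For a real number $y$, $y^{1/3}$ denotes the real cube root of $y$, and $y^{2/3}=(y^{1/3})^2$. Definition. Let $p,q,r\in\mathbb{R}$ with $r\neq 0$. The cubic polynomial $x^3+px^2+qx+r$ is called a Ramanujan cubic polynomial (RCP) if all its roots are real and the condition $pr^{1/3}+3r^{2/3}+q=0$ is satisfied. The roots $x_1,x_2,x_3$ are listed with multiplicity (they are nonzero since $r\ne 0$). *)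

theory Defs
  imports
    Complex_Main
    "HOL-Computational_Algebra.Computational_Algebra"
begin

definition cubic :: "real \<Rightarrow> real \<Rightarrow> real \<Rightarrow> real poly" where
  "cubic p q r = [:r, q, p, 1:]"

text \<open>
  The real cube root is \<open>root 3\<close>, which is odd: \<open>root 3 (- y) = - root 3 y\<close>.
  (\<open>y powr (1/3)\<close> would be wrong for negative \<open>y\<close>.)
  That all roots are real is a condition on the complex roots of the polynomial.
\<close>

definition ramanujan_cubic :: "real \<Rightarrow> real \<Rightarrow> real \<Rightarrow> bool" where
  "ramanujan_cubic p q r \<longleftrightarrow>
     r \<noteq> 0 \<and>
     (\<forall>z::complex. poly (map_poly complex_of_real (cubic p q r)) z = 0 \<longrightarrow> z \<in> \<real>) \<and>
     p * root 3 r + 3 * (root 3 r)\<^sup>2 + q = 0"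

end

theory Submission
  imports Defs
begin

text \<open>
  Write \<open>a, b, c\<close> for the real cube roots of the three roots, and let \<open>u = a + b + c\<close>,
  \<open>v = ab + bc + ca\<close>, \<open>m = abc\<close> and \<open>w = uv\<close>. The six terms on the left become
  \<open>a/b + b/a + \<dots>\<close>; over the common denominator \<open>m\<close> their sum is \<open>(w - 3m) / m\<close>.

  By Vieta, the coefficients are \<open>p = -A\<close>, \<open>q = B\<close> and \<open>r = -m\<^sup>3\<close>, where
  \<open>A = a\<^sup>3 + b\<^sup>3 + c\<^sup>3 = u\<^sup>3 - 3w + 3m\<close> and
  \<open>B = a\<^sup>3b\<^sup>3 + b\<^sup>3c\<^sup>3 + c\<^sup>3a\<^sup>3 = v\<^sup>3 - 3wm + 3m\<^sup>2\<close>. Since the cube root of \<open>r\<close> is \<open>-m\<close>,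
  Ramanujan's condition reads \<open>H = 0\<close> for \<open>H = Am + 3m\<^sup>2 + B\<close>. In terms of \<open>u\<close> and \<open>v\<close> this is
  \<open>mu\<^sup>3 + v\<^sup>3 = 6wm - 9m\<^sup>2\<close>, and this combination is the only way in which \<open>u\<close> and \<open>v\<close> enter
  the product \<open>AB\<close> apart from their product \<open>w\<close>. Substituting makes \<open>AB - 9m\<^sup>3\<close> the perfect
  cube \<open>(w - 3m)\<^sup>3\<close>. Division by \<open>m\<^sup>3\<close> shows that \<open>pq/r - 9\<close> is the cube of the left-hand side.
\<close>

text \<open>
  The roots can be divided out one after the other, because splitting off the linear factor
  of one root removes exactly one copy of that root from the multiset.
\<close>

lemma prod_mset_proots_dvd:
  fixes f :: "'a::idom poly"
  assumes "f \<noteq> 0"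
  shows "(\<Prod>x\<in>#proots f. [:- x, 1:]) dvd f"
  using assms
proof (induction "proots f" arbitrary: f)
  case empty
  then show ?case by (simp flip: empty(1))
next
  case (add a M)
  have "a \<in> set_mset (proots f)"
    by (simp flip: add.hyps(2))
  then have "poly f a = 0"
    using add.prems by simp
  then obtain g where g: "f = [:- a, 1:] * g"
    by (auto simp: poly_eq_0_iff_dvd)
  with add.prems have "g \<noteq> 0" by auto
  with g add.prems have "proots f = add_mset a (proots g)"
    by (simp add: proots_mult del: mult_pCons_left)
  moreover from this have "M = proots g"
    using add.hyps(2) by simp
  then have "(\<Prod>x\<in>#proots g. [:- x, 1:]) dvd g"
    using add.hyps(1) \<open>g \<noteq> 0\<close> by blast
  ultimately show ?case
    by (simp add: g mult_dvd_mono del: mult_pCons_left)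
qed

lemma cubic_vieta:
  assumes "proots (cubic p q r) = {#x1, x2, x3#}"
  shows "p = - (x1 + x2 + x3)" and "q = x1 * x2 + x2 * x3 + x3 * x1" and "r = - (x1 * x2 * x3)"
proof -
  define g where "g = [:- x1, 1:] * [:- x2, 1:] * [:- x3, 1:]"
  have g_coeffs: "g = [:- (x1 * x2 * x3), x1 * x2 + x2 * x3 + x3 * x1, - (x1 + x2 + x3), 1:]"
    by (simp add: g_def algebra_simps)
  have "cubic p q r \<noteq> 0" by (simp add: cubic_def)
  from prod_mset_proots_dvd[OF this] have "g dvd cubic p q r"
    by (simp add: assms g_def mult.assoc del: mult_pCons_left mult_pCons_right)
  then obtain h where h: "cubic p q r = g * h" ..
  \<comment> \<open>The cubic and \<open>g\<close> are monic of the same degree, so the cofactor is \<open>1\<close>.\<close>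
  have "h \<noteq> 0" "g \<noteq> 0" using h by (auto simp: cubic_def)
  then have "degree (cubic p q r) = degree g + degree h"
    by (simp add: h degree_mult_eq)
  then have "degree h = 0" by (simp add: cubic_def g_coeffs)
  then obtain k where "h = [:k:]" by (metis degree_eq_zeroE)
  with h show "p = - (x1 + x2 + x3)" "q = x1 * x2 + x2 * x3 + x3 * x1" "r = - (x1 * x2 * x3)"
    by (auto simp: cubic_def g_coeffs)
qed

text \<open>
  The summand \<open>3 (m - w) H\<close>, with \<open>H\<close> the left-hand side of the assumption and \<open>m\<close>, \<open>w\<close> as above,
  is exactly the difference between the two sides of the conclusion.
\<close>

lemma ramanujan_perfect_cube:
  fixes a b c :: "'a::comm_ring_1"
  assumes "(a^3 + b^3 + c^3) * (a * b * c) + 3 * (a * b * c)^2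
             + (a^3 * b^3 + b^3 * c^3 + c^3 * a^3) = 0"
  shows "(a^3 + b^3 + c^3) * (a^3 * b^3 + b^3 * c^3 + c^3 * a^3) - 9 * (a * b * c)^3
           = ((a + b + c) * (a * b + b * c + c * a) - 3 * (a * b * c))^3" (is "?L = ?R")
proof -
  let ?m = "a * b * c" and ?w = "(a + b + c) * (a * b + b * c + c * a)"
  have "?L = ?R + 3 * (?m - ?w) *
    ((a^3 + b^3 + c^3) * ?m + 3 * ?m^2 + (a^3 * b^3 + b^3 * c^3 + c^3 * a^3))"
    by (simp add: algebra_simps power2_eq_square power3_eq_cube)
  then show ?thesis by (simp only: assms mult_zero_right add_0_right)
qed

theorem theorem4:
  fixes p q r x1 x2 x3 :: real
  assumes "ramanujan_cubic p q r"
    and "proots (cubic p q r) = {#x1, x2, x3#}"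
  shows "root 3 (x1 / x2) + root 3 (x2 / x1) + root 3 (x1 / x3) + root 3 (x3 / x1)
           + root 3 (x2 / x3) + root 3 (x3 / x2)
         = root 3 (p * q / r - 9)"
proof -
  define a b c where "a = root 3 x1" and "b = root 3 x2" and "c = root 3 x3"
  define A where "A = a^3 + b^3 + c^3"
  define B where "B = a^3 * b^3 + b^3 * c^3 + c^3 * a^3"
  define m where "m = a * b * c"
  define n where "n = (a + b + c) * (a * b + b * c + c * a) - 3 * m"
  have cubes: "x1 = a^3" "x2 = b^3" "x3 = c^3"
    by (simp_all add: a_def b_def c_def odd_real_root_pow)
  have coeffs: "p = - A" "q = B" "r = - (m^3)"
    using cubic_vieta[OF assms(2)]
    by (simp_all add: cubes A_def B_def m_def power_mult_distrib)
  from assms(1) have "r \<noteq> 0" and cond: "p * root 3 r + 3 * (root 3 r)^2 + q = 0"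
    by (simp_all add: ramanujan_cubic_def)
  then have "m \<noteq> 0" by (auto simp: coeffs)
  then have nz: "a \<noteq> 0" "b \<noteq> 0" "c \<noteq> 0" by (auto simp: m_def)
  have "root 3 r = - m"
    by (simp add: coeffs real_root_minus odd_real_root_power_cancel)
  with cond have "A * m + 3 * m^2 + B = 0" by (simp add: coeffs)
  then have perfect_cube: "A * B - 9 * m^3 = n^3"
    unfolding A_def B_def m_def n_def by (rule ramanujan_perfect_cube)
  have "p * q / r - 9 = (A * B - 9 * m^3) / m^3"
    using \<open>m \<noteq> 0\<close> by (simp add: coeffs field_simps)
  also have "\<dots> = (n / m)^3"
    by (simp add: perfect_cube power_divide)
  finally have "root 3 (p * q / r - 9) = n / m"
    by (simp add: odd_real_root_power_cancel)
  also have "\<dots> = a / b + b / a + a / c + c / a + b / c + c / b"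
    unfolding n_def m_def using nz by (simp add: field_simps)
  also have "\<dots> = root 3 (x1 / x2) + root 3 (x2 / x1) + root 3 (x1 / x3) + root 3 (x3 / x1)
      + root 3 (x2 / x3) + root 3 (x3 / x2)"
    by (simp add: a_def b_def c_def real_root_divide)
  finally show ?thesis ..
qed

end
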